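(* Consider the ordinary differential equation $$\left(\frac{t\,y'(t)}{y(t)}\right)'=y(t)-\frac{t}{(y(t))^2}.\qquad (\mathrm{P})$$ (Direct part.) If $y(t)$ is an algebroid solution of $(\mathrm{P})$, then there exist $n,m\in\mathbb{Z}_{\geqslant 0}$ and $\alpha=(m+2n+3)/4$ such that $$y(t)=x^{n+1-\alpha}w(x),\qquad t=x^{\alpha},$$ where the function $w(x)$, which is holomorphic at $x=0$ with $w(0)\neq 0$, is the unique solution (holomorphic at $x=0$ with the given value $w(0)$) of the equation $$\left(\frac{x\,w'(x)}{w(x)}\right)'=\alpha^2\left(x^n w(x)-\frac{x^m}{(w(x))^2}\right).\qquad (\mathrm{W})$$ (Converse part.) For any $n,m\in\mathbb{Z}_{\geqslant 0}$, $\alpha=(m+2n+3)/4$, and any $a_0\in\mathbb{C}\setminus\{0\}$, there exists a unique solution $w(x)$ of $(\mathrm{W})$ that is holomorphic at $x=0$ and satisfies $w(0)=-a_0$; this $w$ defines, via $y(t)=x^{n+1-\alpha}w(x)$, $t=x^{\alpha}$, an algebroid solution of $(\mathrm{P})$.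
   Context: Equation $(\mathrm{P})$ is the degenerate third Painlevé equation $y''=\frac{(y')^2}{y}-\frac{y'}{t}+\frac{y^2}{t}-\frac1y$ in compact form. It has the Painlevé property: every solution continues to a meromorphic function on the universal cover of $\mathbb{C}\setminus\{0\}$, so $t=0$ is the only possible branch point in $\mathbb{C}$. An algebroid function is a (finitely many-valued) analytic function $y(t)$ satisfying an irreducible polynomial equation whose coefficients are meromorphic functions on $\mathbb{C}$; for a solution of $(\mathrm{P})$ this means that there is $N\in\mathbb{N}$ such that $y(x^N)$ is single-valued near $x=0$ and is holomorphic or has a pole of finite order there. Fractional powers $t=x^\alpha$ are understood on the Riemann surface of the logarithm. *)

theory Defs
  imports "HOL-Complex_Analysis.Complex_Analysis"
begin

text \<open>
  Multivalued functions of \<open>t\<close> are functions on the Riemann surface of the logarithm, that is, on the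
  universal cover of \<open>\<complex> - {0}\<close>. That surface is identified with \<open>\<complex>\<close>: the point \<open>s\<close> lies over
  \<open>t = exp s\<close>, the power \<open>t\<^sup>\<beta>\<close> is \<open>exp (\<beta> * s)\<close>, and the substitution \<open>t = x\<^sup>\<alpha>\<close> is \<open>s = \<alpha> * u\<close>, where
  \<open>u\<close> is the point of the surface with \<open>x = exp u\<close>. A multivalued function \<open>y(t)\<close> is thus represented
  by the function \<open>Y\<close> with \<open>Y s = y(exp s)\<close>. The half-planes \<open>Re s < c\<close> are the punctured discs
  \<open>0 < \<bar>t\<bar> < exp c\<close>, with arbitrary argument of \<open>t\<close>.
\<close>

text \<open>The derivative \<open>dy/dt\<close>, by the chain rule for \<open>t = exp s\<close>.\<close>

definition deriv_t :: "(complex \<Rightarrow> complex) \<Rightarrow> complex \<Rightarrow> complex" where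
  "deriv_t Y s = deriv Y s / exp s"

definition domain_at_0 :: "complex set \<Rightarrow> bool" where
  "domain_at_0 S \<longleftrightarrow> open S \<and> connected S \<and> (\<exists>c. {s. Re s < c} \<subseteq> S)"

text \<open>
  The equation \<open>(t y'/y)' = y - t/y\<^sup>2\<close>. A solution may have zeros and poles, at which the two sides are
  not defined, so the equation is required off a discrete set. The condition \<open>Y s \<noteq> 0\<close> excludes the
  function \<open>0\<close>, which would satisfy the equation because of the convention \<open>a / 0 = 0\<close>.
\<close>

definition solution_P :: "(complex \<Rightarrow> complex) \<Rightarrow> complex set \<Rightarrow> bool" where
  "solution_P Y S \<longleftrightarrow>
     Y nicely_meromorphic_on S \<and>
     (\<forall>\<^sub>\<approx>s\<in>S. Y s \<noteq> 0 \<and>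
        deriv_t (\<lambda>r. exp r * deriv_t Y r / Y r) s = Y s - exp s / (Y s)\<^sup>2)"

text \<open>
  For some \<open>N \<ge> 1\<close> the function \<open>y(x\<^sup>N)\<close> is, near \<open>x = 0\<close>, a single-valued function \<open>f\<close> of \<open>x\<close> that is
  holomorphic or has a pole of finite order at \<open>x = 0\<close>.
\<close>

definition algebroid :: "(complex \<Rightarrow> complex) \<Rightarrow> bool" where
  "algebroid Y \<longleftrightarrow>
     (\<exists>N::nat. N > 0 \<and> (\<exists>f c. f meromorphic_on {0} \<and>
        (\<forall>u. Re u < c \<longrightarrow> Y (of_nat N * u) = f (exp u))))"

text \<open>
  By the Painleve property every solution near \<open>t = 0\<close> continues to the whole surface, \<open>S = UNIV\<close>.
  Smaller domains are allowed, as in the usual notion of a solution of a differential equation.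
\<close>

definition algebroid_solution_P :: "(complex \<Rightarrow> complex) \<Rightarrow> complex set \<Rightarrow> bool" where
  "algebroid_solution_P Y S \<longleftrightarrow> domain_at_0 S \<and> solution_P Y S \<and> algebroid Y"

text \<open>
  \<open>w\<close> is holomorphic at \<open>0\<close> and \<open>(x w'/w)' = \<alpha>\<^sup>2 (x\<^sup>n w - x\<^sup>m/w\<^sup>2)\<close> near \<open>0\<close>. Since the equation divides by
  \<open>w\<close> at \<open>x = 0\<close> as well, this includes \<open>w 0 \<noteq> 0\<close>.
\<close>

definition holomorphic_solution_W ::
    "complex \<Rightarrow> nat \<Rightarrow> nat \<Rightarrow> (complex \<Rightarrow> complex) \<Rightarrow> bool" where
  "holomorphic_solution_W \<alpha> n m w \<longleftrightarrow>
     w analytic_on {0} \<and>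
     (\<forall>\<^sub>F x in nhds 0. w x \<noteq> 0 \<and>
        deriv (\<lambda>z. z * deriv w z / w z) x = \<alpha>\<^sup>2 * (x ^ n * w x - x ^ m / (w x)\<^sup>2))"

text \<open>Uniqueness is uniqueness of the germ at \<open>0\<close>.\<close>

definition unique_holomorphic_solution_W ::
    "complex \<Rightarrow> nat \<Rightarrow> nat \<Rightarrow> (complex \<Rightarrow> complex) \<Rightarrow> bool" where
  "unique_holomorphic_solution_W \<alpha> n m w \<longleftrightarrow>
     holomorphic_solution_W \<alpha> n m w \<and>
     (\<forall>v. holomorphic_solution_W \<alpha> n m v \<and> v 0 = w 0 \<longrightarrow> (\<forall>\<^sub>F x in nhds 0. v x = w x))"

text \<open>\<open>y(t) = x\<^bsup>n+1-\<alpha>\<^esup> w(x)\<close> with \<open>t = x\<^sup>\<alpha>\<close>, near \<open>x = 0\<close> on the Riemann surface of the logarithm.\<close>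

definition given_by :: "complex \<Rightarrow> nat \<Rightarrow> (complex \<Rightarrow> complex) \<Rightarrow> (complex \<Rightarrow> complex) \<Rightarrow> bool" where
  "given_by \<alpha> n w Y \<longleftrightarrow>
     (\<exists>c. \<forall>u. Re u < c \<longrightarrow> Y (\<alpha> * u) = exp ((of_nat n + 1 - \<alpha>) * u) * w (exp u))"

end

theory Submission
  imports Defs
begin

text \<open>
  An algebroid solution satisfies \<open>y(x\<^sup>N) = x\<^sup>k g(x)\<close> with \<open>g\<close> holomorphic and \<open>g(0) \<noteq> 0\<close>, and the equation
  becomes \<open>x (x g'/g)' = N\<^sup>2 (x\<^sup>p g - x\<^sup>q/g\<^sup>2)\<close> with \<open>p = N + k\<close> and \<open>q = 2(N - k)\<close>. The left-hand side
  vanishes at \<open>0\<close> and \<open>2p + q = 4N > 0\<close>, so neither power on the right can be nonpositive: this forces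
  \<open>p = n + 1\<close>, \<open>q = m + 1\<close> and \<open>\<alpha> = N\<close>.

  Writing \<open>w = w(0) e\<^sup>h\<close> turns (W) into \<open>(x h')' = F(x, h)\<close> with \<open>h(0) = 0\<close>. On the disc of radius \<open>r\<close> the
  operator \<open>h \<mapsto> (x h')'\<close> on functions vanishing at \<open>0\<close> has an inverse of norm at most \<open>r\<close> for the
  supremum norm, so Picard iteration yields existence and uniqueness for small \<open>r\<close>.
  The equation (P), known near \<open>t = 0\<close>, extends to the whole domain by the identity theorem.
\<close>

subsection \<open>The equation \<open>(x f')' = F(x, f)\<close>\<close>

lemma deriv_times_deriv_diff:
  assumes "f holomorphic_on S" "g holomorphic_on S" "open S" "z \<in> S"
  shows "deriv (\<lambda>x. x * deriv (\<lambda>y. f y - g y) x) z =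
    deriv (\<lambda>x. x * deriv f x) z - deriv (\<lambda>x. x * deriv g x) z"
proof -
  have dd: "(\<lambda>x. x * deriv h x) field_differentiable at z" if "h holomorphic_on S" for h
    using that assms by (intro holomorphic_on_imp_differentiable_at[of _ S] holomorphic_intros)
  have ev: "\<forall>\<^sub>F x in nhds z. x * deriv (\<lambda>y. f y - g y) x = x * deriv f x - x * deriv g x"
    using eventually_nhds_in_open[OF assms(3,4)]
  proof eventually_elim
    case (elim x)
    have "deriv (\<lambda>y. f y - g y) x = deriv f x - deriv g x"
      using elim assms by (intro deriv_diff holomorphic_on_imp_differentiable_at[of _ S])
    then show ?case by (simp only: right_diff_distrib)
  qed
  have "deriv (\<lambda>x. x * deriv (\<lambda>y. f y - g y) x) z = deriv (\<lambda>x. x * deriv f x - x * deriv g x) z"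
    by (rule deriv_cong_ev[OF ev refl])
  also have "\<dots> = deriv (\<lambda>x. x * deriv f x) z - deriv (\<lambda>x. x * deriv g x) z"
    by (intro deriv_diff dd assms)
  finally show ?thesis .
qed

text \<open>The mean value inequality is used twice. The function x f' vanishes at 0 and its
  derivative is bounded by M, so |x f'| \<le> M |x| and hence |f'| \<le> M. The same inequality for
  f, which also vanishes at 0, gives the claim.\<close>

lemma norm_le_of_deriv_times_deriv_le:
  assumes f: "f holomorphic_on ball 0 r" "f 0 = 0"
    and le: "\<And>z. z \<in> ball 0 r \<Longrightarrow> norm (deriv (\<lambda>x. x * deriv f x) z) \<le> M"
    and z: "z \<in> ball 0 r"
  shows "norm (f z) \<le> M * norm z"
proof -
  have r: "r > 0" using z by (metis ball_eq_empty empty_iff not_le_imp_less)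
  have hol: "deriv f holomorphic_on ball 0 r" "(\<lambda>x. x * deriv f x) holomorphic_on ball 0 r"
    using f by (auto intro!: holomorphic_intros)
  have bd: "norm (y * deriv f y) \<le> M * norm y" if "y \<in> ball 0 r" for y
  proof -
    have "norm (y * deriv f y - 0 * deriv f 0) \<le> M * norm (y - 0)"
      by (rule field_differentiable_bound[OF convex_ball[of 0 r], where f' = "deriv (\<lambda>x. x * deriv f x)"])
        (use that r le in \<open>auto intro!: holomorphic_derivI[OF hol(2)]\<close>)
    then show ?thesis by simp
  qed
  \<comment> \<open>Division by y is impossible at y = 0, but there (x f')' = f' + x f'' reduces to
    f'.\<close>
  have d0: "deriv (\<lambda>x. x * deriv f x) 0 = deriv f 0"
  proof (rule DERIV_imp_deriv)
    have "(deriv f has_field_derivative deriv (deriv f) 0) (at 0)"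
      using r by (intro holomorphic_derivI[OF hol(1)]) auto
    from DERIV_mult[OF DERIV_ident this]
    show "((\<lambda>x. x * deriv f x) has_field_derivative deriv f 0) (at 0)"
      by simp
  qed
  have bd': "norm (deriv f y) \<le> M" if "y \<in> ball 0 r" for y
  proof (cases "y = 0")
    case True
    then show ?thesis using le[of 0] r d0 by simp
  next
    case False
    then show ?thesis using bd[OF that] by (simp add: norm_mult mult.commute)
  qed
  have "norm (f z - f 0) \<le> M * norm (z - 0)"
    by (rule field_differentiable_bound[OF convex_ball[of 0 r], where f' = "deriv f"])
      (use z r bd' in \<open>auto intro!: holomorphic_derivI[OF f(1)]\<close>)
  then show ?thesis using f by simp
qed

text \<open>Two integrations invert the operator: G is the primitive of f with G(0) = 0, and g is
  the primitive of G(x)/x, whose singularity at 0 is removable because G(0) = 0.\<close>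

lemma deriv_times_deriv_surj:
  assumes f: "f holomorphic_on ball 0 r" and r: "r > 0"
  obtains g where "g holomorphic_on ball 0 r" "g 0 = 0"
    "\<And>z. z \<in> ball 0 r \<Longrightarrow> deriv (\<lambda>x. x * deriv g x) z = f z"
proof -
  have prim: "\<exists>g. g 0 = 0 \<and> (\<forall>z\<in>ball 0 r. (g has_field_derivative h z) (at z))"
    if h: "h holomorphic_on ball 0 r" for h :: "complex \<Rightarrow> complex"
  proof -
    obtain g where g: "\<And>x. x \<in> ball 0 r \<Longrightarrow> (g has_field_derivative h x) (at x within ball 0 r)"
      using holomorphic_convex_primitive'[OF convex_ball open_ball h] by blast
    have "((\<lambda>x. g x - g 0) has_field_derivative h z) (at z)" if "z \<in> ball 0 r" for z
    proof -
      have "(g has_field_derivative h z) (at z)"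
        using g[OF that] that by (metis at_within_open open_ball)
      from DERIV_diff[OF this DERIV_const[of "g 0"]] show ?thesis by simp
    qed
    then show ?thesis by (intro exI[of _ "\<lambda>x. g x - g 0"]) auto
  qed
  obtain G where G: "G 0 = 0" "\<And>z. z \<in> ball 0 r \<Longrightarrow> (G has_field_derivative f z) (at z)"
    using prim[OF f] by blast
  have Ghol: "G holomorphic_on ball 0 r"
    using G(2) by (subst holomorphic_on_open) blast+
  define q where "q = (\<lambda>z. if z = 0 then deriv G 0 else (G z - G 0) / (z - 0))"
  have q: "q holomorphic_on ball 0 r"
    unfolding q_def by (rule pole_lemma_open[OF Ghol open_ball])
  obtain g where g: "g 0 = 0" "\<And>z. z \<in> ball 0 r \<Longrightarrow> (g has_field_derivative q z) (at z)"
    using prim[OF q] by blast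
  show ?thesis
  proof
    show "g holomorphic_on ball 0 r" using g(2) by (subst holomorphic_on_open) blast+
    show "g 0 = 0" by fact
    fix z :: complex assume z: "z \<in> ball 0 r"
    have "\<forall>\<^sub>F x in nhds z. x * deriv g x = G x"
      using eventually_nhds_in_open[OF open_ball z]
    proof eventually_elim
      case (elim x)
      have "deriv g x = q x" using g(2)[OF elim] by (rule DERIV_imp_deriv)
      then show ?case using G(1) by (simp add: q_def)
    qed
    then have "deriv (\<lambda>x. x * deriv g x) z = deriv G z"
      by (rule deriv_cong_ev) simp
    also have "\<dots> = f z" using G(2)[OF z] by (rule DERIV_imp_deriv)
    finally show "deriv (\<lambda>x. x * deriv g x) z = f z" .
  qed
qed

section \<open>Picard iteration\<close>

text \<open>The right-hand sides differ by at most K e, so the norm bound gives K e |z| \<le> r K e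
  \<le> e/2. Keeping the arguments \<open>p\<close>, \<open>q\<close> apart from the solutions
  \<open>f\<close>, \<open>g\<close> lets the estimate serve both uniqueness, with p = f and q = g,
  and the iteration, where \<open>f\<close> is the image of \<open>p\<close>.\<close>

lemma deriv_times_deriv_contraction:
  fixes F :: "complex \<Rightarrow> complex \<Rightarrow> complex"
  assumes lip: "\<And>x u v. \<lbrakk>x \<in> ball 0 r; norm u \<le> 1; norm v \<le> 1\<rbrakk> \<Longrightarrow> norm (F x u - F x v) \<le> K * norm (u - v)"
    and rK: "K \<ge> 0" "r * K \<le> 1 / 2"
    and f: "f holomorphic_on ball 0 r" and g: "g holomorphic_on ball 0 r" and fg: "f 0 = g 0"
    and p: "\<And>x. x \<in> ball 0 r \<Longrightarrow> norm (p x) \<le> 1" and q: "\<And>x. x \<in> ball 0 r \<Longrightarrow> norm (q x) \<le> 1"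
    and Ff: "\<And>x. x \<in> ball 0 r \<Longrightarrow> deriv (\<lambda>x. x * deriv f x) x = F x (p x)"
    and Fg: "\<And>x. x \<in> ball 0 r \<Longrightarrow> deriv (\<lambda>x. x * deriv g x) x = F x (q x)"
    and e: "\<And>x. x \<in> ball 0 r \<Longrightarrow> norm (p x - q x) \<le> e"
    and z: "z \<in> ball 0 r"
  shows "norm (f z - g z) \<le> e / 2"
proof -
  have "norm (f z - g z) \<le> (K * e) * norm z"
  proof (rule norm_le_of_deriv_times_deriv_le[OF _ _ _ z])
    show "(\<lambda>z. f z - g z) holomorphic_on ball 0 r" using f g by (intro holomorphic_intros)
    show "f 0 - g 0 = 0" using fg by simp
    fix x :: complex assume x: "x \<in> ball 0 r"
    have "norm (deriv (\<lambda>x. x * deriv (\<lambda>y. f y - g y) x) x) = norm (F x (p x) - F x (q x))"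
      using deriv_times_deriv_diff[OF f g open_ball x] Ff[OF x] Fg[OF x] by simp
    also have "\<dots> \<le> K * norm (p x - q x)" using lip x p q by blast
    also have "\<dots> \<le> K * e" using e[OF x] rK by (intro mult_left_mono)
    finally show "norm (deriv (\<lambda>x. x * deriv (\<lambda>y. f y - g y) x) x) \<le> K * e" .
  qed
  also have "\<dots> \<le> (K * e) * r"
  proof (rule mult_left_mono)
    show "norm z \<le> r" using z by simp
    show "0 \<le> K * e" using rK e[OF z] by (meson mult_nonneg_nonneg norm_ge_zero order_trans)
  qed
  also have "\<dots> = (r * K) * e" by simp
  also have "\<dots> \<le> (1 / 2) * e"
    using rK e[OF z] by (intro mult_right_mono) (auto intro: order_trans[OF norm_ge_zero])
  finally show ?thesis by simp
qed

text \<open>Each application of the contraction halves a uniform bound on f - g. The initial bound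
  is 2, since both functions map into the unit disc.\<close>

lemma deriv_times_deriv_ode_unique:
  fixes F :: "complex \<Rightarrow> complex \<Rightarrow> complex"
  assumes lip: "\<And>x u v. \<lbrakk>x \<in> ball 0 r; norm u \<le> 1; norm v \<le> 1\<rbrakk> \<Longrightarrow> norm (F x u - F x v) \<le> K * norm (u - v)"
    and rK: "K \<ge> 0" "r * K \<le> 1 / 2"
    and f: "f holomorphic_on ball 0 r" and g: "g holomorphic_on ball 0 r" and fg: "f 0 = g 0"
    and f1: "\<And>x. x \<in> ball 0 r \<Longrightarrow> norm (f x) \<le> 1" and g1: "\<And>x. x \<in> ball 0 r \<Longrightarrow> norm (g x) \<le> 1"
    and Ff: "\<And>x. x \<in> ball 0 r \<Longrightarrow> deriv (\<lambda>x. x * deriv f x) x = F x (f x)"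
    and Fg: "\<And>x. x \<in> ball 0 r \<Longrightarrow> deriv (\<lambda>x. x * deriv g x) x = F x (g x)"
    and z: "z \<in> ball 0 r"
  shows "f z = g z"
proof -
  have le: "norm (f x - g x) \<le> 2 * (1 / 2) ^ k" if "x \<in> ball 0 r" for x k
    using that
  proof (induction k arbitrary: x)
    case 0
    have "norm (f x - g x) \<le> norm (f x) + norm (g x)" by (rule norm_triangle_ineq4)
    then show ?case using f1[OF 0] g1[OF 0] by simp
  next
    case (Suc k)
    have "norm (f x - g x) \<le> 2 * (1 / 2) ^ k / 2"
      by (rule deriv_times_deriv_contraction[where F = F and p = f and q = g and K = K])
        (use lip rK f g fg f1 g1 Ff Fg Suc in auto)
    then show ?case by simp
  qed
  have "(\<lambda>k. 2 * (1 / 2) ^ k :: real) \<longlonglongrightarrow> 2 * 0"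
    by (intro tendsto_intros LIMSEQ_power_zero) auto
  then have "norm (f z - g z) \<le> 2 * 0"
    by (rule LIMSEQ_le_const) (use le[OF z] in blast)
  then show ?thesis by simp
qed

text \<open>Picard iteration on the set \<open>X\<close> of holomorphic maps into the closed unit
  disc that vanish at 0. The condition \<open>r * B \<le> 1\<close> makes \<open>X\<close>
  invariant, and \<open>r * K \<le> 1 / 2\<close> makes the map a contraction for the supremum
  norm.\<close>

lemma deriv_times_deriv_ode_exists:
  fixes F :: "complex \<Rightarrow> complex \<Rightarrow> complex"
  assumes lip: "\<And>x u v. \<lbrakk>x \<in> ball 0 r; norm u \<le> 1; norm v \<le> 1\<rbrakk> \<Longrightarrow> norm (F x u - F x v) \<le> K * norm (u - v)"
    and bound: "\<And>x u. \<lbrakk>x \<in> ball 0 r; norm u \<le> 1\<rbrakk> \<Longrightarrow> norm (F x u) \<le> B"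
    and hol: "\<And>f. f holomorphic_on ball 0 r \<Longrightarrow> (\<lambda>x. F x (f x)) holomorphic_on ball 0 r"
    and r: "r > 0" "K \<ge> 0" "r * K \<le> 1 / 2" "r * B \<le> 1"
  obtains f where "f holomorphic_on ball 0 r" "f 0 = 0"
    "\<And>x. x \<in> ball 0 r \<Longrightarrow> deriv (\<lambda>x. x * deriv f x) x = F x (f x)"
proof -
  define X where "X = {f. f holomorphic_on ball 0 r \<and> f 0 = 0 \<and> (\<forall>x\<in>ball 0 r. norm (f x :: complex) \<le> 1)}"
  have "\<exists>g\<in>X. \<forall>x\<in>ball 0 r. deriv (\<lambda>x. x * deriv g x) x = F x (f x)" if "f \<in> X" for f
  proof -
    have f: "f holomorphic_on ball 0 r" "\<And>x. x \<in> ball 0 r \<Longrightarrow> norm (f x) \<le> 1"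
      using that by (auto simp: X_def)
    obtain g where g: "g holomorphic_on ball 0 r" "g 0 = 0"
      "\<And>z. z \<in> ball 0 r \<Longrightarrow> deriv (\<lambda>x. x * deriv g x) z = F z (f z)"
      using deriv_times_deriv_surj[OF hol[OF f(1)] r(1)] by blast
    have "norm (g z) \<le> 1" if z: "z \<in> ball 0 r" for z
    proof -
      have B: "B \<ge> 0" using bound[of 0 0] r by (auto intro: order_trans[OF norm_ge_zero])
      have "norm (g z) \<le> B * norm z"
        by (rule norm_le_of_deriv_times_deriv_le[OF g(1,2) _ z]) (use g(3) bound f in auto)
      also have "\<dots> \<le> B * r" using z B by (intro mult_left_mono) auto
      also have "\<dots> \<le> 1" using r by (simp add: mult.commute)
      finally show ?thesis .
    qed
    then show ?thesis using g by (auto simp: X_def)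
  qed
  then obtain T where T: "\<And>f. f \<in> X \<Longrightarrow> T f \<in> X"
    "\<And>f x. f \<in> X \<Longrightarrow> x \<in> ball 0 r \<Longrightarrow> deriv (\<lambda>x. x * deriv (T f) x) x = F x (f x)"
    by metis
  have contr: "norm (T f z - T g z) \<le> e / 2"
    if fg: "f \<in> X" "g \<in> X" and e: "\<And>x. x \<in> ball 0 r \<Longrightarrow> norm (f x - g x) \<le> e" and z: "z \<in> ball 0 r"
    for f g e z
    by (rule deriv_times_deriv_contraction[where F = F and p = f and q = g and K = K and r = r])
      (use lip r T fg e z in \<open>auto simp: X_def\<close>)
  define h where "h = (\<lambda>k. (T ^^ k) (\<lambda>_. 0))"
  have h_Suc: "h (Suc k) = T (h k)" for k by (simp add: h_def)
  have h: "h k \<in> X" for k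
    by (induction k) (auto simp: h_Suc T, auto simp: h_def X_def)
  have h_diff: "norm (h (Suc k) z - h k z) \<le> (1 / 2) ^ k" if "z \<in> ball 0 r" for k z
    using that
  proof (induction k arbitrary: z)
    case 0
    then show ?case using h[of 1] by (simp add: X_def, simp add: h_def)
  next
    case (Suc k)
    have "norm (T (h (Suc k)) z - T (h k) z) \<le> (1 / 2) ^ k / 2"
      by (rule contr) (use h Suc in auto)
    then show ?case by (simp add: h_Suc)
  qed
  \<comment> \<open>The limit of the iterates is written as a telescoping series, so that the M-test
    with a geometric majorant yields uniform convergence and hence a holomorphic limit.\<close>
  define H where "H = (\<lambda>z. \<Sum>k. h (Suc k) z - h k z)"
  have "uniform_limit (ball 0 r) (\<lambda>n z. \<Sum>k<n. h (Suc k) z - h k z) H sequentially"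
    unfolding H_def by (rule Weierstrass_m_test[where M = "\<lambda>k. (1 / 2) ^ k"]) (use h_diff in auto)
  moreover have "(\<lambda>n z. \<Sum>k<n. h (Suc k) z - h k z) = h"
    by (intro ext, subst sum_lessThan_telescope) (simp add: h_def)
  ultimately have lim: "uniform_limit (ball 0 r) h H sequentially" by simp
  have lim': "(\<lambda>k. h k z) \<longlonglongrightarrow> H z" if "z \<in> ball 0 r" for z
    using tendsto_uniform_limitI[OF lim that] .
  have "H \<in> X"
  proof -
    have "H holomorphic_on ball 0 r"
    proof (rule holomorphic_uniform_sequence[OF open_ball, where f = h])
      show "h n holomorphic_on ball 0 r" for n using h[of n] by (simp add: X_def)
      fix x :: complex assume "x \<in> ball 0 r"
      then obtain d where "d > 0" "cball x d \<subseteq> ball 0 r"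
        using open_contains_cball open_ball by blast
      then show "\<exists>d>0. cball x d \<subseteq> ball 0 r \<and> uniform_limit (cball x d) h H sequentially"
        using uniform_limit_on_subset[OF lim] by blast
    qed
    moreover have "H 0 = 0"
      using lim'[of 0] r h by (simp add: X_def LIMSEQ_const_iff)
    moreover have "norm (H x) \<le> 1" if "x \<in> ball 0 r" for x
      by (rule Lim_norm_ubound[OF _ lim'[OF that]]) (use h that in \<open>auto simp: X_def\<close>)
    ultimately show ?thesis by (simp add: X_def)
  qed
  \<comment> \<open>The shifted iterates converge to \<open>T H\<close> by the contraction estimate
    and to \<open>H\<close> by construction.\<close>
  have fixed: "T H z = H z" if z: "z \<in> ball 0 r" for z
  proof -
    have "(\<lambda>k. h (Suc k) z) \<longlonglongrightarrow> T H z"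
    proof (rule tendstoI)
      fix e :: real assume e: "e > 0"
      from uniform_limitD[OF lim e]
      show "\<forall>\<^sub>F k in sequentially. dist (h (Suc k) z) (T H z) < e"
      proof eventually_elim
        case (elim k)
        have "norm (T (h k) z - T H z) \<le> e / 2"
          by (rule contr) (use h \<open>H \<in> X\<close> z elim in \<open>auto simp: dist_norm less_imp_le\<close>)
        then show ?case using e by (simp add: dist_norm h_Suc)
      qed
    qed
    then show ?thesis
      using LIMSEQ_Suc[OF lim'[OF z]] by (rule LIMSEQ_unique)
  qed
  \<comment> \<open>The witness is \<open>T H\<close> instead of \<open>H\<close>: its equation has
    right-hand side \<open>F x (H x)\<close> by the choice of \<open>T\<close>, so the fixed point
    property is needed for values only and not for derivatives.\<close>
  show ?thesis
  proof
    show "T H holomorphic_on ball 0 r" "T H 0 = 0" using T(1)[OF \<open>H \<in> X\<close>] by (auto simp: X_def)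
    show "deriv (\<lambda>x. x * deriv (T H) x) x = F x (T H x)" if "x \<in> ball 0 r" for x
      using T(2)[OF \<open>H \<in> X\<close> that] fixed[OF that] by simp
  qed
qed

subsection \<open>Holomorphic solutions of (W)\<close>

definition W_rhs :: "complex \<Rightarrow> nat \<Rightarrow> nat \<Rightarrow> complex \<Rightarrow> complex \<Rightarrow> complex \<Rightarrow> complex" where
  "W_rhs \<alpha> n m b x u = \<alpha>\<^sup>2 * (x ^ n * (b * exp u) - x ^ m / (b * exp u)\<^sup>2)"

text \<open>Compactness of the product of two closed unit discs bounds both the function and its
  derivative \<open>W'\<close> in u, and the mean value inequality turns the latter bound into a
  Lipschitz constant. The maximum with 1 makes \<open>K\<close> positive, so that 1/(2K) is a
  legitimate radius.\<close>

lemma W_rhs_bounds: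
  assumes b: "b \<noteq> 0"
  obtains K where "K > 0" "\<And>x u. \<lbrakk>norm x \<le> 1; norm u \<le> 1\<rbrakk> \<Longrightarrow> norm (W_rhs \<alpha> n m b x u) \<le> K"
    "\<And>x u v. \<lbrakk>norm x \<le> 1; norm u \<le> 1; norm v \<le> 1\<rbrakk> \<Longrightarrow>
      norm (W_rhs \<alpha> n m b x u - W_rhs \<alpha> n m b x v) \<le> K * norm (u - v)"
proof -
  let ?D = "cball 0 1 \<times> cball 0 1 :: (complex \<times> complex) set"
  define W' where "W' = (\<lambda>x u. \<alpha>\<^sup>2 * (x ^ n * (b * exp u) + 2 * x ^ m / (b * exp u)\<^sup>2))"
  have D: "compact ?D" by (intro compact_Times compact_cball)
  have "continuous_on ?D (\<lambda>(x, u). W_rhs \<alpha> n m b x u)"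
    unfolding W_rhs_def case_prod_beta using b by (intro continuous_intros) auto
  from compact_imp_bounded[OF compact_continuous_image[OF this D]]
  obtain K1 where K1: "\<And>x u. \<lbrakk>norm x \<le> 1; norm u \<le> 1\<rbrakk> \<Longrightarrow> norm (W_rhs \<alpha> n m b x u) \<le> K1"
    by (fastforce simp: bounded_iff)
  have "continuous_on ?D (\<lambda>(x, u). W' x u)"
    unfolding W'_def case_prod_beta using b by (intro continuous_intros) auto
  from compact_imp_bounded[OF compact_continuous_image[OF this D]]
  obtain K2 where K2: "\<And>x u. \<lbrakk>norm x \<le> 1; norm u \<le> 1\<rbrakk> \<Longrightarrow> norm (W' x u) \<le> K2"
    by (fastforce simp: bounded_iff)
  have der: "(W_rhs \<alpha> n m b x has_field_derivative W' x u) (at u within cball 0 1)" for x u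
    unfolding W_rhs_def W'_def using b
    by (auto intro!: derivative_eq_intros simp: field_simps power2_eq_square)
  show ?thesis
  proof
    show "max 1 (max K1 K2) > 0" by simp
    show "norm (W_rhs \<alpha> n m b x u) \<le> max 1 (max K1 K2)" if "norm x \<le> 1" "norm u \<le> 1" for x u
      using K1[OF that] by simp
    show "norm (W_rhs \<alpha> n m b x u - W_rhs \<alpha> n m b x v) \<le> max 1 (max K1 K2) * norm (u - v)"
      if "norm x \<le> 1" "norm u \<le> 1" "norm v \<le> 1" for x u v
      by (rule field_differentiable_bound[OF convex_cball[of 0 1], where f' = "W' x"])
        (use that K2[OF that(1)] der in \<open>auto simp: le_max_iff_disj\<close>)
  qed
qed

section \<open>From w to its logarithm; uniqueness and existence for (W)\<close>

lemma analytic_at_eventually_differentiable: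
  assumes "f analytic_on {z}"
  shows "\<forall>\<^sub>F x in nhds z. f field_differentiable at x"
proof -
  obtain S where "open S" "z \<in> S" "f holomorphic_on S"
    using assms by (auto simp: analytic_at)
  then show ?thesis
    unfolding eventually_nhds by (blast intro: holomorphic_on_imp_differentiable_at)
qed

lemma holomorphic_solution_W_cong:
  assumes "\<forall>\<^sub>F x in nhds 0. v x = w x"
  shows "holomorphic_solution_W \<alpha> n m v \<longleftrightarrow> holomorphic_solution_W \<alpha> n m w"
proof -
  \<comment> \<open>The equation contains a derivative inside a derivative, so agreement at nearby
    points has to be propagated through three nested neighbourhoods.\<close>
  have "\<forall>\<^sub>F x in nhds 0. \<forall>\<^sub>F y in nhds x. \<forall>\<^sub>F z in nhds y. v z = w z"
    using assms by (simp add: eventually_eventually)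
  then have "\<forall>\<^sub>F x in nhds 0. v x = w x \<and>
      deriv (\<lambda>z. z * deriv v z / v z) x = deriv (\<lambda>z. z * deriv w z / w z) x"
  proof eventually_elim
    case (elim x)
    then have "\<forall>\<^sub>F z in nhds x. z * deriv v z / v z = z * deriv w z / w z"
    proof eventually_elim
      case (elim y)
      then show ?case using deriv_cong_ev[OF elim refl] eventually_nhds_x_imp_x[OF elim] by simp
    qed
    then have "deriv (\<lambda>z. z * deriv v z / v z) x = deriv (\<lambda>z. z * deriv w z / w z) x"
      by (rule deriv_cong_ev) simp
    then show ?case using eventually_nhds_x_imp_x[OF eventually_nhds_x_imp_x[OF elim]] by simp
  qed
  then have "(\<forall>\<^sub>F x in nhds 0. v x \<noteq> 0 \<and>
        deriv (\<lambda>z. z * deriv v z / v z) x = \<alpha>\<^sup>2 * (x ^ n * v x - x ^ m / (v x)\<^sup>2)) \<longleftrightarrow>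
      (\<forall>\<^sub>F x in nhds 0. w x \<noteq> 0 \<and>
        deriv (\<lambda>z. z * deriv w z / w z) x = \<alpha>\<^sup>2 * (x ^ n * w x - x ^ m / (w x)\<^sup>2))"
    by (intro eventually_subst) (auto elim!: eventually_mono)
  moreover have "v analytic_on {0} \<longleftrightarrow> w analytic_on {0}"
    using assms by (intro analytic_at_cong) auto
  ultimately show ?thesis by (simp add: holomorphic_solution_W_def)
qed

text \<open>The logarithmic derivative of b exp(h) is h', which makes the left-hand side of (W)
  linear in h. The condition that w does not vanish holds automatically.\<close>

lemma holomorphic_solution_W_exp_iff:
  assumes h: "h analytic_on {0}" and b: "b \<noteq> 0"
  shows "holomorphic_solution_W \<alpha> n m (\<lambda>x. b * exp (h x)) \<longleftrightarrow>
    (\<forall>\<^sub>F x in nhds 0. deriv (\<lambda>z. z * deriv h z) x = W_rhs \<alpha> n m b x (h x))"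
proof -
  let ?w = "\<lambda>x. b * exp (h x)"
  have "\<forall>\<^sub>F x in nhds 0. \<forall>\<^sub>F y in nhds x. h field_differentiable at y"
    using analytic_at_eventually_differentiable[OF h] by (simp add: eventually_eventually)
  then have "\<forall>\<^sub>F x in nhds 0. deriv (\<lambda>z. z * deriv ?w z / ?w z) x = deriv (\<lambda>z. z * deriv h z) x"
  proof eventually_elim
    case (elim x)
    then have "\<forall>\<^sub>F z in nhds x. z * deriv ?w z / ?w z = z * deriv h z"
    proof eventually_elim
      case (elim z)
      then have "(h has_field_derivative deriv h z) (at z)"
        by (simp add: DERIV_deriv_iff_field_differentiable)
      then have "(?w has_field_derivative b * (exp (h z) * deriv h z)) (at z)"
        by (auto intro!: derivative_eq_intros)
      then show ?case using b by (simp add: DERIV_imp_deriv)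
    qed
    then show ?case by (rule deriv_cong_ev) simp
  qed
  then have "(\<forall>\<^sub>F x in nhds 0. ?w x \<noteq> 0 \<and>
        deriv (\<lambda>z. z * deriv ?w z / ?w z) x = \<alpha>\<^sup>2 * (x ^ n * ?w x - x ^ m / (?w x)\<^sup>2)) \<longleftrightarrow>
      (\<forall>\<^sub>F x in nhds 0. deriv (\<lambda>z. z * deriv h z) x = W_rhs \<alpha> n m b x (h x))"
    by (intro eventually_subst) (use b in \<open>auto elim!: eventually_mono simp: W_rhs_def\<close>)
  moreover have "?w analytic_on {0}" using h by (intro analytic_intros)
  ultimately show ?thesis by (simp add: holomorphic_solution_W_def)
qed

text \<open>The quotient w/w(0) equals 1 at 0, away from the branch cut, so its principal logarithm
  is analytic at 0 and vanishes there.\<close>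

lemma analytic_at_0_eq_exp:
  assumes w: "w analytic_on {0}" "w 0 \<noteq> 0"
  obtains h where "h analytic_on {0}" "h 0 = 0" "\<forall>\<^sub>F x in nhds 0. w x = w 0 * exp (h x)"
proof
  show "(\<lambda>x. Ln (w x / w 0)) analytic_on {0}"
    using w by (intro analytic_intros) auto
  show "Ln (w 0 / w 0) = 0" using w by simp
  have "\<forall>\<^sub>F x in nhds 0. w x \<noteq> 0"
    using analytic_at_imp_isCont[OF w(1)] w(2)
    by (auto simp: isCont_def tendsto_at_iff_tendsto_nhds intro: tendsto_imp_eventually_ne)
  then show "\<forall>\<^sub>F x in nhds 0. w x = w 0 * exp (Ln (w x / w 0))"
    by eventually_elim (use w in simp)
qed

text \<open>Both solutions have the form b exp(h) with the same b and h(0) = 0. Their logarithms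
  solve the same equation and stay in the unit disc near 0, where the contraction argument
  applies.\<close>

lemma holomorphic_solution_W_unique:
  assumes w: "holomorphic_solution_W \<alpha> n m w" and v: "holomorphic_solution_W \<alpha> n m v"
    and eq: "v 0 = w 0"
  shows "\<forall>\<^sub>F x in nhds 0. v x = w x"
proof -
  define b where "b = w 0"
  have b: "b \<noteq> 0" using w eventually_nhds_x_imp_x by (force simp: holomorphic_solution_W_def b_def)
  have ex: "\<exists>h. h analytic_on {0} \<and> h 0 = 0 \<and> (\<forall>\<^sub>F x in nhds 0. w x = b * exp (h x)) \<and>
      (\<forall>\<^sub>F x in nhds 0. h field_differentiable at x \<and> norm (h x) \<le> 1 \<and>
         deriv (\<lambda>z. z * deriv h z) x = W_rhs \<alpha> n m b x (h x))"
    if w: "holomorphic_solution_W \<alpha> n m w" and w0: "w 0 = b" for w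
  proof -
    have "w analytic_on {0}" "w 0 \<noteq> 0" using w b w0 by (auto simp: holomorphic_solution_W_def)
    then obtain h where h: "h analytic_on {0}" "h 0 = 0" "\<forall>\<^sub>F x in nhds 0. w x = w 0 * exp (h x)"
      using analytic_at_0_eq_exp by blast
    have "holomorphic_solution_W \<alpha> n m (\<lambda>x. b * exp (h x))"
      using w holomorphic_solution_W_cong[OF h(3)] w0 by simp
    then have "\<forall>\<^sub>F x in nhds 0. deriv (\<lambda>z. z * deriv h z) x = W_rhs \<alpha> n m b x (h x)"
      using holomorphic_solution_W_exp_iff[OF h(1) b] by simp
    moreover have "\<forall>\<^sub>F x in nhds 0. norm (h x) < 1"
    proof (rule order_tendstoD)
      have "(h \<longlongrightarrow> h 0) (nhds 0)"
        using analytic_at_imp_isCont[OF h(1)] by (simp add: isCont_def tendsto_at_iff_tendsto_nhds)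
      then show "((\<lambda>x. norm (h x)) \<longlongrightarrow> 0) (nhds 0)"
        using h(2) tendsto_norm_zero by metis
    qed simp
    ultimately have "\<forall>\<^sub>F x in nhds 0. h field_differentiable at x \<and> norm (h x) \<le> 1 \<and>
         deriv (\<lambda>z. z * deriv h z) x = W_rhs \<alpha> n m b x (h x)"
      using analytic_at_eventually_differentiable[OF h(1)] by eventually_elim auto
    then show ?thesis using h w0 by auto
  qed
  obtain g where g: "g 0 = 0" "\<forall>\<^sub>F x in nhds 0. w x = b * exp (g x)"
    "\<forall>\<^sub>F x in nhds 0. g field_differentiable at x \<and> norm (g x) \<le> 1 \<and>
         deriv (\<lambda>z. z * deriv g z) x = W_rhs \<alpha> n m b x (g x)"
    using ex[OF w b_def[symmetric]] by blast
  obtain h where h: "h 0 = 0" "\<forall>\<^sub>F x in nhds 0. v x = b * exp (h x)"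
    "\<forall>\<^sub>F x in nhds 0. h field_differentiable at x \<and> norm (h x) \<le> 1 \<and>
         deriv (\<lambda>z. z * deriv h z) x = W_rhs \<alpha> n m b x (h x)"
    using ex[OF v eq[folded b_def]] by blast
  obtain K where K: "K > 0"
    "\<And>x u v. \<lbrakk>norm x \<le> 1; norm u \<le> 1; norm v \<le> 1\<rbrakk> \<Longrightarrow>
      norm (W_rhs \<alpha> n m b x u - W_rhs \<alpha> n m b x v) \<le> K * norm (u - v)"
    using W_rhs_bounds[OF b] by metis
  obtain d where d: "d > 0" "\<And>x. x \<in> ball 0 d \<Longrightarrow> g field_differentiable at x \<and> norm (g x) \<le> 1 \<and>
         deriv (\<lambda>z. z * deriv g z) x = W_rhs \<alpha> n m b x (g x)"
      "\<And>x. x \<in> ball 0 d \<Longrightarrow> h field_differentiable at x \<and> norm (h x) \<le> 1 \<and>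
         deriv (\<lambda>z. z * deriv h z) x = W_rhs \<alpha> n m b x (h x)"
    using eventually_conj[OF g(3) h(3)] unfolding eventually_nhds_metric
    by (auto simp: dist_commute)
  \<comment> \<open>The radius is at most d for the two equations to hold, at most 1 for the bounds
    on \<open>W_rhs\<close>, and at most 1/(2K) for the contraction.\<close>
  define r where "r = min d (min 1 (1 / (2 * K)))"
  have r: "r > 0" "r \<le> d" "r \<le> 1" "r \<le> 1 / (2 * K)" using d K by (auto simp: r_def)
  have rK: "r * K \<le> 1 / 2" using mult_right_mono[OF r(4), of K] K(1) by simp
  have rd: "x \<in> ball 0 d" if "x \<in> ball 0 r" for x :: complex using that r by simp
  have hol: "g holomorphic_on ball 0 r" "h holomorphic_on ball 0 r"
    unfolding holomorphic_on_def using d(2,3) rd by (meson field_differentiable_at_within)+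
  have gh: "h x = g x" if "x \<in> ball 0 r" for x
    by (rule deriv_times_deriv_ode_unique[where F = "W_rhs \<alpha> n m b" and K = K and r = r])
      (use K rK hol r g(1) h(1) that d(2,3)[OF rd] in simp_all)
  have "\<forall>\<^sub>F x in nhds 0. x \<in> ball 0 r"
    using r by (intro eventually_nhds_in_open) auto
  then show ?thesis using g(2) h(2) by eventually_elim (simp add: gh)
qed

text \<open>Picard iteration produces the logarithm h. One constant \<open>K\<close> is both bound
  and Lipschitz constant, so \<open>r * K \<le> 1 / 2\<close> supplies invariance as well as
  contraction.\<close>

lemma holomorphic_solution_W_exists:
  assumes b: "b \<noteq> 0"
  obtains w where "holomorphic_solution_W \<alpha> n m w" "w 0 = b"
proof -
  obtain K where K: "K > 0" "\<And>x u. \<lbrakk>norm x \<le> 1; norm u \<le> 1\<rbrakk> \<Longrightarrow> norm (W_rhs \<alpha> n m b x u) \<le> K"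
    "\<And>x u v. \<lbrakk>norm x \<le> 1; norm u \<le> 1; norm v \<le> 1\<rbrakk> \<Longrightarrow>
      norm (W_rhs \<alpha> n m b x u - W_rhs \<alpha> n m b x v) \<le> K * norm (u - v)"
    using W_rhs_bounds[OF b] by metis
  define r where "r = min 1 (1 / (2 * K))"
  have r: "r > 0" "r \<le> 1" "r \<le> 1 / (2 * K)" using K by (auto simp: r_def)
  have rK: "r * K \<le> 1 / 2" using mult_right_mono[OF r(3), of K] K(1) by simp
  obtain h where h: "h holomorphic_on ball 0 r" "h 0 = 0"
    "\<And>x. x \<in> ball 0 r \<Longrightarrow> deriv (\<lambda>x. x * deriv h x) x = W_rhs \<alpha> n m b x (h x)"
  proof (rule deriv_times_deriv_ode_exists[where F = "W_rhs \<alpha> n m b" and K = K and B = K and r = r])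
    show "(\<lambda>x. W_rhs \<alpha> n m b x (f x)) holomorphic_on ball 0 r" if "f holomorphic_on ball 0 r" for f
      unfolding W_rhs_def using that b by (intro holomorphic_intros) auto
  qed (use K r rK in auto)
  have "h analytic_on {0}" using h r by (auto simp: analytic_at intro!: exI[of _ "ball 0 r"])
  moreover have "\<forall>\<^sub>F x in nhds 0. deriv (\<lambda>z. z * deriv h z) x = W_rhs \<alpha> n m b x (h x)"
    unfolding eventually_nhds using h r by (intro exI[of _ "ball 0 r"]) auto
  ultimately have "holomorphic_solution_W \<alpha> n m (\<lambda>x. b * exp (h x))"
    using holomorphic_solution_W_exp_iff b by blast
  then show ?thesis using that h(2) by force
qed

subsection \<open>The substitution \<open>t = x\<^sup>\<alpha>\<close>\<close>

text \<open>Since t d/dt = (1/\<alpha>) x d/dx, the quantity t y'/y equals (\<beta> + x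
  w'/w)/\<alpha>. The second derivative in t removes the constant \<beta> and brings in the factor
  x/(\<alpha> t), where x = exp u and t = exp(\<alpha> u).\<close>

lemma deriv_t_log_deriv_t:
  assumes w: "w holomorphic_on ball 0 (exp c) - {0}"
    and nz: "\<And>x. x \<in> ball 0 (exp c) - {0} \<Longrightarrow> w x \<noteq> 0"
    and \<alpha>: "\<alpha> \<noteq> 0"
    and Y: "\<And>u. Re u < c \<Longrightarrow> Y (\<alpha> * u) = exp (\<beta> * u) * w (exp u)"
    and u: "Re u < c"
  shows "deriv_t (\<lambda>r. exp r * deriv_t Y r / Y r) (\<alpha> * u) =
    exp (u - \<alpha> * u) / \<alpha>\<^sup>2 * deriv (\<lambda>x. x * deriv w x / w x) (exp u)"
proof -
  let ?B = "ball 0 (exp c) - {0} :: complex set"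
  let ?L = "\<lambda>x. x * deriv w x / w x"
  \<comment> \<open>The image of the half-plane Re u < c under u -> \<alpha> u, a rotated half-plane
    if \<alpha> is not real.\<close>
  define U where "U = {s. Re (s / \<alpha>) < c}"
  have B: "open ?B" by (intro open_delete open_ball)
  have U: "open U" unfolding U_def using \<alpha> by (intro open_Collect_less continuous_intros) auto
  have inB: "exp (s / \<alpha>) \<in> ?B" if "s \<in> U" for s using that by (simp add: U_def)
  have Y': "Y s = exp (\<beta> * (s / \<alpha>)) * w (exp (s / \<alpha>))" if "s \<in> U" for s
    using Y[of "s / \<alpha>"] that \<alpha> by (simp add: U_def)
  have dE: "((\<lambda>s. exp (s / \<alpha>)) has_field_derivative exp (s / \<alpha>) / \<alpha>) (at s)" for s
    using \<alpha> by (auto intro!: derivative_eq_intros)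
  have eq: "exp s * deriv_t Y s / Y s = (\<beta> + ?L (exp (s / \<alpha>))) / \<alpha>" if s: "s \<in> U" for s
  proof -
    have dw: "(w has_field_derivative deriv w (exp (s / \<alpha>))) (at (exp (s / \<alpha>)))"
      using w B inB[OF s] by (intro holomorphic_derivI)
    have "((\<lambda>s. exp (\<beta> * (s / \<alpha>)) * w (exp (s / \<alpha>))) has_field_derivative
        exp (\<beta> * (s / \<alpha>)) * (\<beta> / \<alpha>) * w (exp (s / \<alpha>)) +
        deriv w (exp (s / \<alpha>)) * (exp (s / \<alpha>) / \<alpha>) * exp (\<beta> * (s / \<alpha>))) (at s)"
      using \<alpha> by (intro DERIV_mult DERIV_chain2[where f = w and g = "\<lambda>s. exp (s / \<alpha>)", OF dw] dE) (auto intro!: derivative_eq_intros)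
    then have "(Y has_field_derivative
        exp (\<beta> * (s / \<alpha>)) * (\<beta> / \<alpha>) * w (exp (s / \<alpha>)) +
        deriv w (exp (s / \<alpha>)) * (exp (s / \<alpha>) / \<alpha>) * exp (\<beta> * (s / \<alpha>))) (at s)"
      by (rule has_field_derivative_transform_within_open[OF _ U s]) (use Y' in auto)
    then show ?thesis
      using Y'[OF s] nz[OF inB[OF s]] \<alpha> by (simp add: deriv_t_def DERIV_imp_deriv field_simps)
  qed
  have s: "\<alpha> * u \<in> U" using u \<alpha> by (simp add: U_def)
  have "?L holomorphic_on ?B" using w nz B by (intro holomorphic_intros) auto
  then have dL: "(?L has_field_derivative deriv ?L (exp (\<alpha> * u / \<alpha>))) (at (exp (\<alpha> * u / \<alpha>)))"
    using B inB[OF s] by (intro holomorphic_derivI)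
  have "((\<lambda>s. (\<beta> + ?L (exp (s / \<alpha>))) / \<alpha>) has_field_derivative
      (0 + deriv ?L (exp (\<alpha> * u / \<alpha>)) * (exp (\<alpha> * u / \<alpha>) / \<alpha>)) / \<alpha>) (at (\<alpha> * u))"
    by (intro DERIV_cdivide DERIV_add DERIV_const DERIV_chain2[where f = ?L and g = "\<lambda>s. exp (s / \<alpha>)", OF dL] dE)
  then have "((\<lambda>r. exp r * deriv_t Y r / Y r) has_field_derivative
      (0 + deriv ?L (exp (\<alpha> * u / \<alpha>)) * (exp (\<alpha> * u / \<alpha>) / \<alpha>)) / \<alpha>) (at (\<alpha> * u))"
    by (rule has_field_derivative_transform_within_open[OF _ U s]) (use eq in auto)
  then show ?thesis
    using \<alpha> unfolding deriv_t_def[of "\<lambda>r. exp r * deriv_t Y r / Y r"]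
    by (simp add: DERIV_imp_deriv exp_diff field_simps power2_eq_square)
qed

text \<open>Each side of (P) is the corresponding side of the equation for w times the nonzero
  factor 1/(\<alpha>^2 t). The exponents \<alpha> + \<beta> and 2(\<alpha> - \<beta>) stay inside
  exponentials, so the equivalence covers fractional powers too.\<close>

lemma equation_P_iff:
  assumes w: "w holomorphic_on ball 0 (exp c) - {0}"
    and nz: "\<And>x. x \<in> ball 0 (exp c) - {0} \<Longrightarrow> w x \<noteq> 0"
    and \<alpha>: "\<alpha> \<noteq> 0"
    and Y: "\<And>u. Re u < c \<Longrightarrow> Y (\<alpha> * u) = exp (\<beta> * u) * w (exp u)"
    and u: "Re u < c"
  shows "deriv_t (\<lambda>r. exp r * deriv_t Y r / Y r) (\<alpha> * u) = Y (\<alpha> * u) - exp (\<alpha> * u) / (Y (\<alpha> * u))\<^sup>2 \<longleftrightarrow>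
    exp u * deriv (\<lambda>x. x * deriv w x / w x) (exp u) =
      \<alpha>\<^sup>2 * (exp ((\<alpha> + \<beta>) * u) * w (exp u) - exp (2 * (\<alpha> - \<beta>) * u) / (w (exp u))\<^sup>2)"
    (is "?l = ?r \<longleftrightarrow> ?l' = ?r'")
proof -
  have "w (exp u) \<noteq> 0" using nz u by simp
  have l: "?l = ?l' * (exp (- (\<alpha> * u)) / \<alpha>\<^sup>2)"
    by (subst deriv_t_log_deriv_t[OF assms]) (simp_all add: exp_diff exp_minus field_simps)
  have r: "?r = ?r' * (exp (- (\<alpha> * u)) / \<alpha>\<^sup>2)"
  proof -
    have 1: "exp ((\<alpha> + \<beta>) * u) * exp (- (\<alpha> * u)) = exp (\<beta> * u)"
      by (simp add: exp_add[symmetric] algebra_simps)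
    have 2: "exp (2 * (\<alpha> - \<beta>) * u) * exp (- (\<alpha> * u)) = exp (\<alpha> * u) / (exp (\<beta> * u))\<^sup>2"
      by (simp add: exp_add[symmetric] exp_diff[symmetric] exp_double[symmetric] algebra_simps)
    have "?r' * (exp (- (\<alpha> * u)) / \<alpha>\<^sup>2) =
      exp ((\<alpha> + \<beta>) * u) * exp (- (\<alpha> * u)) * w (exp u) -
      exp (2 * (\<alpha> - \<beta>) * u) * exp (- (\<alpha> * u)) / (w (exp u))\<^sup>2"
      using \<alpha> by (simp add: field_simps)
    also have "\<dots> = exp (\<beta> * u) * w (exp u) - exp (\<alpha> * u) / (exp (\<beta> * u) * w (exp u))\<^sup>2"
      unfolding 1 2 by (simp add: power_mult_distrib)
    finally show ?thesis using Y[OF u] by simp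
  qed
  have "exp (- (\<alpha> * u)) / \<alpha>\<^sup>2 \<noteq> 0" using \<alpha> by simp
  then show ?thesis unfolding l r by (rule mult_right_cancel)
qed

text \<open>If p \<le> 0, then 2p + q > 0 forces q > p; division by x^p isolates C g(x), and all
  other terms tend to 0, contradicting g(0) \<noteq> 0. If q \<le> 0, then p > q, and division by
  x^q isolates C/g(x)^2 in the same way.\<close>

lemma positive_exponents:
  fixes A g :: "complex \<Rightarrow> complex" and p q :: int
  assumes eq: "\<forall>\<^sub>F x in at 0. x * A x = C * (x powi p * g x - x powi q / (g x)\<^sup>2)"
    and A: "isCont A 0" and g: "isCont g 0" "g 0 \<noteq> 0" and C: "C \<noteq> 0" and pq: "2 * p + q > 0"
  shows "p > 0" "q > 0"
proof -
  have pow: "((\<lambda>x. x powi j) \<longlongrightarrow> (0 :: complex)) (at 0)" if "j > 0" for j :: int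
  proof -
    have "((\<lambda>x. x ^ nat j) \<longlongrightarrow> (0 :: complex) ^ nat j) (at 0)" by (intro tendsto_intros)
    then show ?thesis using that by (simp add: power_int_def zero_power)
  qed
  have lim: "(A \<longlongrightarrow> A 0) (at 0)" "(g \<longlongrightarrow> g 0) (at 0)"
    using A g by (auto simp: isCont_def)
  have ev0: "\<forall>\<^sub>F x in at 0. x \<noteq> (0 :: complex)" by (rule eventually_neq_at_within)
  have evg: "\<forall>\<^sub>F x in at 0. g x \<noteq> 0" by (rule tendsto_imp_eventually_ne[OF lim(2) g(2)])
  show "p > 0"
  proof (rule ccontr)
    assume "\<not> p > 0"
    then have p: "1 - p > 0" "q - p > 0" using pq by auto
    have "((\<lambda>x. x powi (1 - p) * A x + C * (x powi (q - p) / (g x)\<^sup>2)) \<longlongrightarrow>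
        0 * A 0 + C * (0 / (g 0)\<^sup>2)) (at 0)"
      using g(2) by (intro tendsto_intros pow p lim) auto
    moreover have "\<forall>\<^sub>F x in at 0. x powi (1 - p) * A x + C * (x powi (q - p) / (g x)\<^sup>2) = C * g x"
      using eq ev0
    proof eventually_elim
      case (elim x)
      have "x powi (1 - p) * A x = x powi (- p) * (x * A x)"
        using elim(2) by (simp add: power_int_diff power_int_minus field_simps)
      also have "\<dots> = C * g x - C * (x powi (q - p) / (g x)\<^sup>2)"
        unfolding elim(1) using elim(2) by (simp add: power_int_diff power_int_minus field_simps)
      finally show ?case by simp
    qed
    ultimately have "((\<lambda>x. C * g x) \<longlongrightarrow> 0) (at 0)" by (simp add: tendsto_cong)
    moreover have "((\<lambda>x. C * g x) \<longlongrightarrow> C * g 0) (at 0)" by (intro tendsto_intros lim)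
    ultimately show False using C g(2) by (metis LIM_unique mult_eq_0_iff)
  qed
  show "q > 0"
  proof (rule ccontr)
    assume "\<not> q > 0"
    then have p: "1 - q > 0" "p - q > 0" using pq by auto
    have "((\<lambda>x. C * (x powi (p - q) * g x) - x powi (1 - q) * A x) \<longlongrightarrow>
        C * (0 * g 0) - 0 * A 0) (at 0)"
      by (intro tendsto_intros pow p lim)
    moreover have "\<forall>\<^sub>F x in at 0. C * (x powi (p - q) * g x) - x powi (1 - q) * A x = C / (g x)\<^sup>2"
      using eq ev0 evg
    proof eventually_elim
      case (elim x)
      have "x powi (1 - q) * A x = x powi (- q) * (x * A x)"
        using elim(2) by (simp add: power_int_diff power_int_minus field_simps)
      also have "\<dots> = C * (x powi (p - q) * g x) - C / (g x)\<^sup>2"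
        unfolding elim(1) using elim(2,3) by (simp add: power_int_diff power_int_minus field_simps)
      finally show ?case by simp
    qed
    ultimately have "((\<lambda>x. C / (g x)\<^sup>2) \<longlongrightarrow> 0) (at 0)" by (simp add: tendsto_cong)
    moreover have "((\<lambda>x. C / (g x)\<^sup>2) \<longlongrightarrow> C / (g 0)\<^sup>2) (at 0)"
      using g(2) by (intro tendsto_intros lim) auto
    ultimately have "C / (g 0)\<^sup>2 = 0" using LIM_unique by blast
    then show False using C g(2) by simp
  qed
qed

subsection \<open>Algebroid solutions of (P)\<close>

lemma holomorphic_on_open_imp_isCont:
  assumes "f holomorphic_on S" "open S" "z \<in> S"
  shows "isCont f z"
  using assms by (metis holomorphic_on_imp_differentiable_at field_differentiable_imp_continuous_at)

text \<open>Fills in the exceptional points at which an equation is not known a priori.\<close>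

lemma isCont_eventually_0_imp_0:
  fixes f :: "complex \<Rightarrow> complex"
  assumes "isCont f z" "\<forall>\<^sub>F x in at z. f x = 0"
  shows "f z = 0"
proof (rule LIM_unique)
  show "f \<midarrow>z\<rightarrow> f z" using assms(1) by (simp add: isCont_def)
  show "f \<midarrow>z\<rightarrow> 0" using assms(2) by (rule tendsto_eventually)
qed

lemma analytic_at_0_nonzero_ball:
  assumes "g analytic_on {0}" "g 0 \<noteq> 0"
  obtains R where "R > 0" "g holomorphic_on ball 0 R" "\<And>x. x \<in> ball 0 R \<Longrightarrow> g x \<noteq> (0 :: complex)"
proof -
  obtain r where r: "r > 0" "g holomorphic_on ball 0 r"
    using assms(1) by (auto simp: analytic_on_def)
  obtain e where e: "e > 0" "\<And>x. dist 0 x < e \<Longrightarrow> g x \<noteq> 0"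
    using continuous_at_avoid[OF analytic_at_imp_isCont[OF assms(1)] assms(2)] by auto
  show ?thesis
    by (rule that[of "min r e"]) (use r e in \<open>auto intro: holomorphic_on_subset\<close>)
qed

text \<open>The number \<alpha> is the \<open>N\<close> supplied by \<open>algebroid\<close>, and w
  is the Laurent series of y(x^N) divided by its leading power of x.\<close>

lemma algebroid_solution_P_imp_W:
  assumes "algebroid_solution_P Y S"
  obtains n m N w where "of_nat N = (of_nat m + 2 * of_nat n + 3) / (4 :: complex)"
    "holomorphic_solution_W (of_nat N) n m w" "given_by (of_nat N) n w Y"
proof -
  obtain c where c: "{s. Re s < c} \<subseteq> S" and S: "open S"
    and sol: "\<forall>\<^sub>\<approx>s\<in>S. Y s \<noteq> 0 \<and> deriv_t (\<lambda>r. exp r * deriv_t Y r / Y r) s = Y s - exp s / (Y s)\<^sup>2"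
    and alg: "algebroid Y"
    using assms by (auto simp: algebroid_solution_P_def domain_at_0_def solution_P_def)
  obtain N f c' where N: "N > 0" and f: "f meromorphic_on {0}"
    and Yf: "\<And>u. Re u < c' \<Longrightarrow> Y (of_nat N * u) = f (exp u)"
    using alg unfolding algebroid_def by blast
  \<comment> \<open>The map v -> N v sends punctured neighbourhoods into punctured neighbourhoods,
    so the discrete exceptional set pulls back to a discrete one.\<close>
  have ev: "\<forall>\<^sub>F v in at u. Y (of_nat N * v) \<noteq> 0 \<and>
      deriv_t (\<lambda>r. exp r * deriv_t Y r / Y r) (of_nat N * v) =
        Y (of_nat N * v) - exp (of_nat N * v) / (Y (of_nat N * v))\<^sup>2"
    if "Re u < c / N" for u
  proof -
    have "of_nat N * u \<in> S" using c that N by (auto simp: field_simps)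
    then have "\<forall>\<^sub>F s in at (of_nat N * u). Y s \<noteq> 0 \<and>
        deriv_t (\<lambda>r. exp r * deriv_t Y r / Y r) s = Y s - exp s / (Y s)\<^sup>2"
      using sol S by (simp add: eventually_cosparse_open_eq)
    moreover have "filterlim (\<lambda>v. of_nat N * v) (at (of_nat N * u)) (at u)"
      using N by (intro filterlim_atI tendsto_intros) (auto simp: eventually_at_filter)
    ultimately show ?thesis
      by (rule eventually_compose_filterlim)
  qed
  obtain F where F: "f has_laurent_expansion F"
    using f by (auto simp: meromorphic_on_def)
  define k where "k = fls_subdegree F"
  define g where "g = eval_fps (fls_base_factor_to_fps F)"
  have fg: "\<forall>\<^sub>F x in at 0. f x = g x * x powi k" and rad: "fls_conv_radius F > 0"
    using F by (auto simp: has_laurent_expansion_def eval_fls_def g_def k_def eq_commute)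
  then obtain R0 where R0: "R0 > 0" "\<And>x. x \<noteq> 0 \<Longrightarrow> norm x < R0 \<Longrightarrow> f x = g x * x powi k"
    by (auto simp: eventually_at)
  \<comment> \<open>Otherwise \<open>Y\<close> would vanish on a left half-plane, against the
    condition that it is nonzero off a discrete set. The point \<open>u\<close> below lies far
    enough to the left for all local descriptions to hold.\<close>
  have "F \<noteq> 0"
  proof
    assume "F = 0"
    then have g0: "g x = 0" for x by (simp add: g_def)
    define u :: complex where "u = of_real (min (min c' (c / N)) (ln R0) - 1)"
    have u: "Re u < c'" "Re u < c / N" "Re u < ln R0" by (auto simp: u_def)
    have "\<forall>\<^sub>F v in at u. v \<in> {v. Re v < c'} \<inter> {v. Re v < ln R0}"
      using u by (intro eventually_at_in_open' open_Int open_halfspace_Re_lt) auto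
    then have "\<forall>\<^sub>F v in at u. False"
      using ev[OF u(2)]
    proof eventually_elim
      case (elim v)
      have "norm (exp v) < R0" using elim R0(1) by (metis IntD2 exp_less_mono exp_ln mem_Collect_eq norm_exp_eq_Re)
      then have "Y (of_nat N * v) = 0" using elim Yf[of v] R0(2)[of "exp v"] g0 by simp
      then show ?case using elim by simp
    qed
    then show False by simp
  qed
  have "g analytic_on {0}"
    unfolding g_def using rad by (intro analytic_on_eval_fps analytic_intros) (auto simp: fls_conv_radius_altdef zero_ereal_def)
  moreover have "g 0 \<noteq> 0"
    using \<open>F \<noteq> 0\<close> by (simp add: g_def eval_fps_at_0)
  ultimately obtain R1 where R1: "R1 > 0" "g holomorphic_on ball 0 R1" "\<And>x. x \<in> ball 0 R1 \<Longrightarrow> g x \<noteq> 0"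
    using analytic_at_0_nonzero_ball by blast
  \<comment> \<open>On Re u < d the factorization of f, the nonvanishing of g, the representation of
    \<open>Y\<close> by f and the equation, pulled back by N, are all available.\<close>
  define d where "d = min (min (ln R0) (ln R1)) (min c' (c / N))"
  have d: "exp d \<le> R0" "exp d \<le> R1" "d \<le> c'" "d \<le> c / N"
    using R0(1) R1(1) by (auto simp: d_def ln_ge_iff[symmetric])
  have g: "g holomorphic_on ball 0 (exp d)" "\<And>x. x \<in> ball 0 (exp d) \<Longrightarrow> g x \<noteq> 0"
    using R1 d(2) by (auto intro: holomorphic_on_subset)
  have Yg: "Y (of_nat N * u) = exp (of_int k * u) * g (exp u)" if "Re u < d" for u
  proof -
    have "norm (exp u) < exp d" using that by simp
    then have "norm (exp u) < R0" using d(1) by linarith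
    then show ?thesis using Yf[of u] R0(2)[of "exp u"] that d(3) by (simp add: exp_power_int)
  qed
  \<comment> \<open>These are the exponents \<alpha> + \<beta> and 2(\<alpha> - \<beta>) for
    \<alpha> = N and \<beta> = k; they satisfy 2p + q = 4N.\<close>
  define p where "p = int N + k"
  define q where "q = 2 * (int N - k)"
  define A where "A = deriv (\<lambda>x. x * deriv g x / g x)"
  have A: "A holomorphic_on ball 0 (exp d)"
    unfolding A_def using g by (intro holomorphic_intros) auto
  have eq: "x * A x = (of_nat N)\<^sup>2 * (x powi p * g x - x powi q / (g x)\<^sup>2)"
    if x: "x \<in> ball 0 (exp d) - {0}" for x
  proof -
    \<comment> \<open>The equation is known for exp v with v off a discrete set. Continuity of
      \<open>D\<close> extends it to every v, and \<open>Ln x\<close> provides a preimage of the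
      given x.\<close>
    define D where "D = (\<lambda>x. x * A x - (of_nat N)\<^sup>2 * (x powi p * g x - x powi q / (g x)\<^sup>2))"
    have "D holomorphic_on ball 0 (exp d) - {0}"
      unfolding D_def using A g by (auto intro!: holomorphic_intros intro: holomorphic_on_subset)
    then have "isCont D x"
      using x by (intro holomorphic_on_open_imp_isCont[of D "ball 0 (exp d) - {0}"] open_delete open_ball)
    define u where "u = Ln x"
    have u: "exp u = x" "Re u < d"
      using x by (auto simp: u_def) (metis exp_gt_zero exp_less_cancel_iff exp_ln norm_le_zero_iff not_le)
    have "isCont (\<lambda>v. D (exp v)) u"
      using \<open>isCont D x\<close> u by (intro isCont_o2[of u exp D] isCont_exp) simp_all
    moreover have "\<forall>\<^sub>F v in at u. v \<in> {v. Re v < d}"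
      using u by (intro eventually_at_in_open' open_halfspace_Re_lt) auto
    then have "\<forall>\<^sub>F v in at u. D (exp v) = 0"
      using ev[OF less_le_trans[OF u(2) d(4)]]
    proof eventually_elim
      case (elim v)
      have "exp v * deriv (\<lambda>x. x * deriv g x / g x) (exp v) =
        (of_nat N)\<^sup>2 * (exp ((of_nat N + of_int k) * v) * g (exp v)
          - exp (2 * (of_nat N - of_int k) * v) / (g (exp v))\<^sup>2)"
        by (rule iffD1[OF equation_P_iff[where Y = Y and c = d and w = g]])
          (use elim g N Yg in \<open>auto intro: holomorphic_on_subset\<close>)
      then show ?case
        by (simp add: D_def A_def p_def q_def exp_power_int)
    qed
    ultimately have "D (exp u) = 0"
      by (rule isCont_eventually_0_imp_0)
    then show ?thesis by (simp add: D_def u)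
  qed
  have zero: "0 \<in> ball 0 (exp d)" by simp
  have cont: "isCont A 0" "isCont g 0"
    using A g(1) by (auto intro!: holomorphic_on_open_imp_isCont[OF _ open_ball zero])
  have "\<forall>\<^sub>F x in at 0. x \<in> ball 0 (exp d) - {0}"
    by (intro eventually_at_in_open) auto
  then have "\<forall>\<^sub>F x in at 0. x * A x = (of_nat N)\<^sup>2 * (x powi p * g x - x powi q / (g x)\<^sup>2)"
    by eventually_elim (rule eq)
  then have pq: "p > 0" "q > 0"
    using positive_exponents[of A "(of_nat N)\<^sup>2" p g q] cont g(2)[OF zero] N by (auto simp: p_def q_def)
  \<comment> \<open>The shift by one accounts for the factor x on the left-hand side, which is
    cancelled below for x \<noteq> 0; continuity then gives the equation at 0.\<close>
  define n where "n = nat (p - 1)"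
  define m where "m = nat (q - 1)"
  have nm: "p = int n + 1" "q = int m + 1" using pq by (auto simp: n_def m_def)
  have eq': "A x = (of_nat N)\<^sup>2 * (x ^ n * g x - x ^ m / (g x)\<^sup>2)" if x: "x \<in> ball 0 (exp d)" for x
  proof -
    define E where "E = (\<lambda>x. A x - (of_nat N)\<^sup>2 * (x ^ n * g x - x ^ m / (g x)\<^sup>2))"
    have E0: "E y = 0" if "y \<in> ball 0 (exp d) - {0}" for y
    proof -
      have "y * A y = y * ((of_nat N)\<^sup>2 * (y ^ n * g y - y ^ m / (g y)\<^sup>2))"
        using that eq[OF that] by (simp add: nm power_int_add algebra_simps)
      then show ?thesis using that by (simp add: E_def)
    qed
    have "E holomorphic_on ball 0 (exp d)"
      unfolding E_def using A g by (intro holomorphic_intros) auto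
    then have "isCont E 0"
      by (rule holomorphic_on_open_imp_isCont[OF _ open_ball zero])
    moreover have "\<forall>\<^sub>F x in at 0. E x = 0"
      using \<open>\<forall>\<^sub>F x in at 0. x \<in> ball 0 (exp d) - {0}\<close> by eventually_elim (rule E0)
    ultimately have "E 0 = 0"
      by (rule isCont_eventually_0_imp_0)
    then have "E x = 0" using E0[of x] x by (cases "x = 0") auto
    then show ?thesis by (simp add: E_def)
  qed
  \<comment> \<open>This is 2p + q = 4N with p = n + 1 and q = m + 1.\<close>
  have "4 * int N = int m + 2 * int n + 3" using nm by (simp add: p_def q_def)
  then have "4 * N = m + 2 * n + 3" by linarith
  then have "of_nat (4 * N) = (of_nat (m + 2 * n + 3) :: complex)" by (rule arg_cong)
  then have 1: "of_nat N = (of_nat m + 2 * of_nat n + 3) / (4 :: complex)" by (simp add: mult.commute)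
  have 2: "holomorphic_solution_W (of_nat N) n m g"
    unfolding holomorphic_solution_W_def
  proof
    show "g analytic_on {0}" by fact
    show "\<forall>\<^sub>F x in nhds 0. g x \<noteq> 0 \<and> deriv (\<lambda>z. z * deriv g z / g z) x =
        (of_nat N)\<^sup>2 * (x ^ n * g x - x ^ m / (g x)\<^sup>2)"
      unfolding eventually_nhds using g(2) eq' by (intro exI[of _ "ball 0 (exp d)"]) (auto simp: A_def)
  qed
  have "k = int n + 1 - int N" using nm by (simp add: p_def)
  then have "(of_int k :: complex) = of_int (int n + 1 - int N)" by (rule arg_cong)
  then have k: "of_int k = (of_nat n + 1 - of_nat N :: complex)" by simp
  have 3: "given_by (of_nat N) n g Y"
    unfolding given_by_def using Yg by (intro exI[of _ d]) (simp add: k)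
  from 1 2 3 show ?thesis by (rule that)
qed

section \<open>Converse part: from (W) to algebroid solutions\<close>

text \<open>Replacing x by x^4 clears the denominators: t becomes x^N with N = 4 \<alpha>, and the
  exponent 4(n + 1 - \<alpha>) = 2n + 1 - m is an integer.\<close>

lemma algebroid_given_by:
  assumes \<alpha>: "\<alpha> = (of_nat m + 2 * of_nat n + 3) / 4"
    and w: "w analytic_on {0}" and Y: "given_by \<alpha> n w Y"
  shows "algebroid Y"
proof -
  define N where "N = m + 2 * n + 3"
  define k where "k = 2 * int n + 1 - int m"
  obtain c where c: "\<And>u. Re u < c \<Longrightarrow> Y (\<alpha> * u) = exp ((of_nat n + 1 - \<alpha>) * u) * w (exp u)"
    using Y by (auto simp: given_by_def)
  have "(\<lambda>x. w (x ^ 4)) analytic_on {0}"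
    by (rule analytic_on_compose_gen[of "\<lambda>x. x ^ 4" _ w "{0}", unfolded o_def]) (use w in \<open>auto intro!: analytic_intros\<close>)
  then have "(\<lambda>x. x powi k * w (x ^ 4)) meromorphic_on {0}"
    by (intro meromorphic_intros analytic_on_imp_meromorphic_on)
  moreover have "Y (of_nat N * u) = exp u powi k * w (exp u ^ 4)" if "Re u < c / 4" for u
  proof -
    have "of_nat N = 4 * \<alpha>" by (simp add: N_def \<alpha>)
    then have "Y (of_nat N * u) = Y (\<alpha> * (4 * u))" by (simp add: ac_simps)
    also have "\<dots> = exp ((of_nat n + 1 - \<alpha>) * (4 * u)) * w (exp (4 * u))"
      using that by (intro c) simp
    also have "(of_nat n + 1 - \<alpha>) * (4 * u) = of_int k * u"
      by (simp add: \<alpha> k_def field_simps)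
    also have "exp (4 * u) = exp u ^ 4"
      using exp_of_nat_mult[of 4 u] by simp
    finally show ?thesis by (simp add: exp_power_int)
  qed
  moreover have "N > 0" by (simp add: N_def)
  ultimately show ?thesis unfolding algebroid_def by blast
qed

text \<open>Identity theorem: a meromorphic function on a connected open set is zero off a discrete
  set or nonzero off a discrete set, and vanishing near z excludes the latter.\<close>

lemma meromorphic_eq_0_cosparse:
  assumes "f meromorphic_on S" "open S" "connected S" "z \<in> S" "\<forall>\<^sub>F x in at z. f x = 0"
  shows "\<forall>\<^sub>\<approx>x\<in>S. f x = 0"
proof (rule ccontr)
  assume "\<not> (\<forall>\<^sub>\<approx>x\<in>S. f x = 0)"
  then have "\<forall>\<^sub>\<approx>x\<in>S. f x \<noteq> 0" using meromorphic_imp_constant_or_avoid assms by blast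
  then have "\<forall>\<^sub>F x in at z. f x \<noteq> 0" using assms by (simp add: eventually_cosparse_open_eq)
  then have "\<forall>\<^sub>F x in at z. False" using assms(5) by eventually_elim simp
  then show False by simp
qed

text \<open>(W) yields (P) at every point of a left half-plane. Both sides of (P) are meromorphic on
  the connected set \<open>S\<close>, which meets that half-plane, so the identity theorem carries
  the equation to all of \<open>S\<close>.\<close>

lemma given_by_imp_algebroid_solution_P:
  assumes \<alpha>: "\<alpha> = (of_nat m + 2 * of_nat n + 3) / 4"
    and w: "holomorphic_solution_W \<alpha> n m w" and S: "domain_at_0 S"
    and mero: "Y nicely_meromorphic_on S" and Y: "given_by \<alpha> n w Y"
  shows "algebroid_solution_P Y S"
proof -
  define a :: real where "a = (of_nat m + 2 * of_nat n + 3) / 4"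
  have a: "\<alpha> = of_real a" "a > 0" by (auto simp: \<alpha> a_def)
  have Sop: "open S" "connected S" using S by (auto simp: domain_at_0_def)
  obtain b where b: "{s. Re s < b} \<subseteq> S" using S by (auto simp: domain_at_0_def)
  obtain c where c: "\<And>u. Re u < c \<Longrightarrow> Y (\<alpha> * u) = exp ((of_nat n + 1 - \<alpha>) * u) * w (exp u)"
    using Y by (auto simp: given_by_def)
  have wan: "w analytic_on {0}" and ev: "\<forall>\<^sub>F x in nhds 0. w x \<noteq> 0 \<and>
      deriv (\<lambda>z. z * deriv w z / w z) x = \<alpha>\<^sup>2 * (x ^ n * w x - x ^ m / (w x)\<^sup>2)"
    using w by (auto simp: holomorphic_solution_W_def)
  obtain R1 where R1: "R1 > 0" "w holomorphic_on ball 0 R1" 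
    using wan by (auto simp: analytic_on_def)
  obtain R2 where R2: "R2 > 0" "\<And>x. norm x < R2 \<Longrightarrow> w x \<noteq> 0"
      "\<And>x. norm x < R2 \<Longrightarrow> deriv (\<lambda>z. z * deriv w z / w z) x = \<alpha>\<^sup>2 * (x ^ n * w x - x ^ m / (w x)\<^sup>2)"
    using ev unfolding eventually_nhds_metric by auto
  define d where "d = min (min (ln R1) (ln R2)) c"
  have d: "exp d \<le> R1" "exp d \<le> R2" "d \<le> c"
    using R1(1) R2(1) by (auto simp: d_def ln_ge_iff[symmetric])
  have wd: "w holomorphic_on ball 0 (exp d) - {0}"
    using R1(2) d by (auto intro: holomorphic_on_subset)
  have P: "Y s \<noteq> 0 \<and> deriv_t (\<lambda>r. exp r * deriv_t Y r / Y r) s = Y s - exp s / (Y s)\<^sup>2"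
    if "Re s < a * d" for s
  proof -
    define u where "u = s / \<alpha>"
    have u: "s = \<alpha> * u" "Re u < d" using that a by (auto simp: u_def field_simps)
    have nu: "norm (exp u) < R2" using u(2) d(2) by (simp add: less_le_trans[OF _ d(2)])
    \<comment> \<open>With \<beta> = n + 1 - \<alpha> the exponents \<alpha> + \<beta> and
      2(\<alpha> - \<beta>) are n + 1 and m + 1; the extra factor x matches the one on the left-hand
      side.\<close>
    have e1: "exp ((\<alpha> + (of_nat n + 1 - \<alpha>)) * u) = exp u * exp u ^ n"
      by (simp add: exp_of_nat_mult[symmetric] exp_add[symmetric] algebra_simps)
    have e2: "exp (2 * (\<alpha> - (of_nat n + 1 - \<alpha>)) * u) = exp u * exp u ^ m"
    proof -
      have "2 * (\<alpha> - (of_nat n + 1 - \<alpha>)) = of_nat m + 1" by (simp add: \<alpha> field_simps)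
      then show ?thesis by (simp add: exp_of_nat_mult[symmetric] exp_add[symmetric] algebra_simps)
    qed
    have "deriv_t (\<lambda>r. exp r * deriv_t Y r / Y r) (\<alpha> * u) = Y (\<alpha> * u) - exp (\<alpha> * u) / (Y (\<alpha> * u))\<^sup>2"
    proof (subst equation_P_iff[OF wd])
      show "exp u * deriv (\<lambda>x. x * deriv w x / w x) (exp u) =
        \<alpha>\<^sup>2 * (exp ((\<alpha> + (of_nat n + 1 - \<alpha>)) * u) * w (exp u) -
          exp (2 * (\<alpha> - (of_nat n + 1 - \<alpha>)) * u) / (w (exp u))\<^sup>2)"
        unfolding e1 e2 R2(3)[OF nu] by (simp add: algebra_simps)
    qed (use a R2(2) d c u in auto)
    then show ?thesis using u c[of u] R2(2)[OF nu] d(3) by auto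
  qed
  \<comment> \<open>A real point lying both in a half-plane contained in \<open>S\<close> and in the
    half-plane where (P) is already known.\<close>
  define z :: complex where "z = of_real (min b (a * d) - 1)"
  have z: "Re z < b" "Re z < a * d" by (auto simp: z_def)
  have "z \<in> S" using z b by auto
  have "\<forall>\<^sub>F s in at z. s \<in> {s. Re s < a * d}"
    using z by (intro eventually_at_in_open' open_halfspace_Re_lt) auto
  then have evP: "\<forall>\<^sub>F s in at z. Y s \<noteq> 0 \<and>
      deriv_t (\<lambda>r. exp r * deriv_t Y r / Y r) s = Y s - exp s / (Y s)\<^sup>2"
    by eventually_elim (use P in auto)
  have Ym: "Y meromorphic_on S" using mero by (simp add: nicely_meromorphic_on_def)
  have expm: "exp meromorphic_on S" by (intro analytic_on_imp_meromorphic_on analytic_intros)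
  have "(\<lambda>s. deriv_t (\<lambda>r. exp r * deriv_t Y r / Y r) s - (Y s - exp s / (Y s)\<^sup>2)) meromorphic_on S"
    unfolding deriv_t_def by (intro meromorphic_intros Ym expm)
  then have "\<forall>\<^sub>\<approx>s\<in>S. deriv_t (\<lambda>r. exp r * deriv_t Y r / Y r) s - (Y s - exp s / (Y s)\<^sup>2) = 0"
    by (rule meromorphic_eq_0_cosparse[OF _ Sop \<open>z \<in> S\<close>]) (use evP in \<open>auto elim: eventually_mono\<close>)
  moreover have "\<forall>\<^sub>\<approx>s\<in>S. Y s \<noteq> 0"
  proof -
    have "\<not> (\<forall>\<^sub>\<approx>s\<in>S. Y s = 0)"
    proof
      assume "\<forall>\<^sub>\<approx>s\<in>S. Y s = 0"
      then have "\<forall>\<^sub>F s in at z. Y s = 0" using Sop \<open>z \<in> S\<close> by (simp add: eventually_cosparse_open_eq)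
      then have "\<forall>\<^sub>F s in at z. False" using evP by eventually_elim simp
      then show False by simp
    qed
    then show ?thesis using meromorphic_imp_constant_or_avoid[OF Ym Sop] by blast
  qed
  ultimately have "\<forall>\<^sub>\<approx>s\<in>S. Y s \<noteq> 0 \<and>
      deriv_t (\<lambda>r. exp r * deriv_t Y r / Y r) s = Y s - exp s / (Y s)\<^sup>2"
    by eventually_elim simp
  then have "solution_P Y S" using mero by (simp add: solution_P_def)
  then show ?thesis
    using S algebroid_given_by[OF \<alpha> wan Y] by (simp add: algebroid_solution_P_def)
qed

text \<open>The formula itself defines \<open>Y\<close> on Re s < a ln R, where x = exp(s/a) stays
  in a disc on which w is holomorphic.\<close>

lemma given_by_exists:
  assumes "a > 0" "w analytic_on {0}"
  obtains Y S where "domain_at_0 S" "Y nicely_meromorphic_on S" "given_by (of_real a) n w Y"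
proof -
  obtain R where R: "R > 0" "w holomorphic_on ball 0 R"
    using assms by (auto simp: analytic_on_def)
  define S where "S = {s. Re s < a * ln R}"
  define Y where "Y = (\<lambda>s. exp ((of_nat n + 1 - of_real a) * (s / of_real a)) * w (exp (s / of_real a)))"
  have "open S" unfolding S_def by (rule open_halfspace_Re_lt)
  have "connected S" unfolding S_def by (intro convex_connected convex_halfspace_Re_lt)
  have inR: "exp (s / of_real a) \<in> ball 0 R" if "s \<in> S" for s
  proof -
    have "Re (s / of_real a) < ln R" using that assms by (simp add: S_def field_simps)
    then have "exp (Re (s / of_real a)) < R" using R(1) by (metis exp_less_mono exp_ln)
    then show ?thesis by simp
  qed
  have "(\<lambda>s. w (exp (s / of_real a))) holomorphic_on S"
    by (rule holomorphic_on_compose_gen[of "\<lambda>s. exp (s / of_real a)" _ w "ball 0 R", unfolded o_def])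
      (use inR R assms in \<open>auto intro!: holomorphic_intros\<close>)
  then have "Y holomorphic_on S"
    unfolding Y_def using assms by (intro holomorphic_intros) auto
  then have "Y analytic_on S" using \<open>open S\<close> by (simp add: analytic_on_open)
  show ?thesis
  proof
    show "domain_at_0 S"
      unfolding domain_at_0_def using \<open>open S\<close> \<open>connected S\<close> by (auto simp: S_def)
    show "Y nicely_meromorphic_on S" using \<open>Y analytic_on S\<close> by (rule analytic_on_imp_nicely_meromorphic_on)
    show "given_by (of_real a) n w Y"
      unfolding given_by_def Y_def using assms by auto
  qed
qed

text \<open>Every holomorphic solution is determined near 0 by its value at 0, so both parts reduce
  to finding some solution.\<close>

lemma unique_holomorphic_solution_W_iff:
  "unique_holomorphic_solution_W \<alpha> n m w \<longleftrightarrow> holomorphic_solution_W \<alpha> n m w"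
  using holomorphic_solution_W_unique by (auto simp: unique_holomorphic_solution_W_def)

theorem theorem3p1:
  shows
    "(\<forall>Y S. algebroid_solution_P Y S \<longrightarrow>
       (\<exists>(n::nat) (m::nat) (\<alpha>::complex) w.
          \<alpha> = (of_nat m + 2 * of_nat n + 3) / 4 \<and>
          w analytic_on {0} \<and> w 0 \<noteq> 0 \<and>
          unique_holomorphic_solution_W \<alpha> n m w \<and>
          given_by \<alpha> n w Y))
     \<and>
     (\<forall>(n::nat) (m::nat) (\<alpha>::complex) (a\<^sub>0::complex).
       \<alpha> = (of_nat m + 2 * of_nat n + 3) / 4 \<and> a\<^sub>0 \<noteq> 0 \<longrightarrow>
       (\<exists>w. unique_holomorphic_solution_W \<alpha> n m w \<and> w 0 = - a\<^sub>0 \<and>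
          (\<exists>Y S. algebroid_solution_P Y S \<and> given_by \<alpha> n w Y) \<and>
          (\<forall>Y S. domain_at_0 S \<and> Y nicely_meromorphic_on S \<and> given_by \<alpha> n w Y
             \<longrightarrow> algebroid_solution_P Y S)))"
proof (intro conjI allI impI)
  fix Y S
  assume "algebroid_solution_P Y S"
  then obtain n m N w where w: "of_nat N = (of_nat m + 2 * of_nat n + 3) / (4 :: complex)"
    "holomorphic_solution_W (of_nat N) n m w" "given_by (of_nat N) n w Y"
    by (rule algebroid_solution_P_imp_W)
  moreover have "w analytic_on {0}" "w 0 \<noteq> 0"
    using w(2) eventually_nhds_x_imp_x unfolding holomorphic_solution_W_def by fast+
  ultimately show "\<exists>(n::nat) (m::nat) (\<alpha>::complex) w.
      \<alpha> = (of_nat m + 2 * of_nat n + 3) / 4 \<and> w analytic_on {0} \<and> w 0 \<noteq> 0 \<and>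
      unique_holomorphic_solution_W \<alpha> n m w \<and> given_by \<alpha> n w Y"
    unfolding unique_holomorphic_solution_W_iff by blast
next
  fix n m :: nat and \<alpha> a\<^sub>0 :: complex
  assume asm: "\<alpha> = (of_nat m + 2 * of_nat n + 3) / 4 \<and> a\<^sub>0 \<noteq> 0"
  then have "- a\<^sub>0 \<noteq> 0" by simp
  then obtain w where w: "holomorphic_solution_W \<alpha> n m w" "w 0 = - a\<^sub>0"
    by (rule holomorphic_solution_W_exists)
  \<comment> \<open>Every meromorphic \<open>Y\<close> that w describes near t = 0 is covered,
    whatever its domain; the explicit \<open>Y\<close> obtained below shows that there is
    one.\<close>
  have conv: "algebroid_solution_P Y S"
    if "domain_at_0 S \<and> Y nicely_meromorphic_on S \<and> given_by \<alpha> n w Y" for Y S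
    using given_by_imp_algebroid_solution_P[OF conjunct1[OF asm] w(1)] that by blast
  have "w analytic_on {0}" using w by (simp add: holomorphic_solution_W_def)
  moreover have "(of_nat m + 2 * of_nat n + 3) / 4 > (0 :: real)" by simp
  ultimately obtain Y S where "domain_at_0 S" "Y nicely_meromorphic_on S"
    "given_by (of_real ((of_nat m + 2 * of_nat n + 3) / 4)) n w Y"
    using given_by_exists by metis
  then have "domain_at_0 S" "Y nicely_meromorphic_on S" "given_by \<alpha> n w Y" by (simp_all add: conjunct1[OF asm])
  then have "\<exists>Y S. algebroid_solution_P Y S \<and> given_by \<alpha> n w Y" using conv by blast
  then show "\<exists>w. unique_holomorphic_solution_W \<alpha> n m w \<and> w 0 = - a\<^sub>0 \<and>
      (\<exists>Y S. algebroid_solution_P Y S \<and> given_by \<alpha> n w Y) \<and>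
      (\<forall>Y S. domain_at_0 S \<and> Y nicely_meromorphic_on S \<and> given_by \<alpha> n w Y
         \<longrightarrow> algebroid_solution_P Y S)"
    unfolding unique_holomorphic_solution_W_iff using w conv by blast
qed

end
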